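(* The following assertion is false: for every classical pattern $q$ there exist constants $c>0$ and $0<c_1<1$ such that, with $r=r(n)=\lfloor c_1 n\rfloor$, $$\sqrt[n]{|\operatorname{Av}_n(\operatorname{dist}_{r}(q))|}\longrightarrow c\quad\text{as } n\to\infty.$$
   Context: A classical pattern is a permutation $q=q_1\cdots q_k\in S_k$. For $r\ge0$, $\operatorname{dist}_r(q)=q_1\square^r q_2\square^r\cdots\square^r q_k$; an occurrence in a permutation $\pi=\pi_1\cdots\pi_n$ of $[n]$ is given by positions $x_1<\cdots<x_k$ with $x_{i+1}-x_i\geq r+1$ for all $1\le i\le k-1$ such that $\pi_{x_1}\cdots\pi_{x_k}$ is in the same relative order as $q$. $\operatorname{Av}_n(\operatorname{dist}_r(q))$ is the set of permutations of $[n]$ with no such occurrence. *)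

theory Defs
  imports Complex_Main "HOL-Combinatorics.Permutations"
begin

text \<open>
  A permutation \<open>\<pi>\<^sub>1\<dots>\<pi>\<^sub>n\<close> of \<open>[n]\<close> is a function \<open>\<pi>\<close> with \<open>\<pi> permutes {1..n}\<close>, its entries being
  \<open>\<pi> 1, \<dots>, \<pi> n\<close>. As such a function does not determine \<open>n\<close>, lengths are separate arguments.
\<close>

definition dist_occurrence ::
  "nat \<Rightarrow> nat \<Rightarrow> (nat \<Rightarrow> nat) \<Rightarrow> nat \<Rightarrow> (nat \<Rightarrow> nat) \<Rightarrow> (nat \<Rightarrow> nat) \<Rightarrow> bool" where
  "dist_occurrence r k q n \<pi> x \<longleftrightarrow>
     (\<forall>i\<in>{1..k}. x i \<in> {1..n}) \<and>
     (\<forall>i\<in>{1..<k}. x i + (r + 1) \<le> x (i + 1)) \<and>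
     (\<forall>i\<in>{1..k}. \<forall>j\<in>{1..k}. \<pi> (x i) < \<pi> (x j) \<longleftrightarrow> q i < q j)"

definition Av_dist :: "nat \<Rightarrow> nat \<Rightarrow> nat \<Rightarrow> (nat \<Rightarrow> nat) \<Rightarrow> (nat \<Rightarrow> nat) set" where
  "Av_dist n r k q = {\<pi>. \<pi> permutes {1..n} \<and> \<not> (\<exists>x. dist_occurrence r k q n \<pi> x)}"

text \<open>
  The length-one pattern is degenerate: no nonempty permutation avoids it, so the roots below tend to
  0 and not to a positive \<open>c\<close>. A refutation that does not rest on it has to restrict to \<open>2 \<le> k\<close>.
\<close>

definition has_linear_dist_growth_rate :: "nat \<Rightarrow> (nat \<Rightarrow> nat) \<Rightarrow> bool" where
  "has_linear_dist_growth_rate k q \<longleftrightarrow>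
     (\<exists>c c\<^sub>1 :: real. 0 < c \<and> 0 < c\<^sub>1 \<and> c\<^sub>1 < 1 \<and>
        (\<lambda>n. root n (real (card (Av_dist n (nat \<lfloor>c\<^sub>1 * real n\<rfloor>) k q)))) \<longlonglongrightarrow> c)"

end

theory Submission imports Defs begin

text \<open>
  Since adjacent entries of an occurrence of \<open>dist\<^sub>r(q)\<close> are more than \<open>r\<close> positions apart, every
  permutation moving only the first \<open>r + 1\<close> positions avoids \<open>dist\<^sub>r(q)\<close> as soon as \<open>q\<close> has a
  descent. For \<open>r\<close> linear in \<open>n\<close> these are \<open>(r + 1)!\<close> many, which outgrows every exponential in
  \<open>n\<close>, so that the \<open>n\<close>-th roots are unbounded. The pattern \<open>21\<close> is such a \<open>q\<close>.
\<close>

text \<open>As \<open>x i\<close> is at least 1, the gap pushes \<open>x (i + 1)\<close> beyond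
  \<open>r + 1\<close>, hence beyond \<open>m\<close>, to a fixed point. The earlier entry
  \<open>\<pi> (x i)\<close> is either still in the prefix or fixed too, so it stays below
  \<open>x (i + 1)\<close>, and the descent of \<open>q\<close> cannot be matched.\<close>

lemma permutes_prefix_subset_Av_dist:
  assumes i: "i \<in> {1..<k}" and descent: "q (i + 1) < q i" and "m \<le> n" "m \<le> r + 1"
  shows "{\<pi>. \<pi> permutes {1..m}} \<subseteq> Av_dist n r k q"
proof (clarsimp simp: Av_dist_def, intro conjI allI)
  fix \<pi> assume \<pi>: "\<pi> permutes {Suc 0..m}"
  show "\<pi> permutes {Suc 0..n}"
    by (rule permutes_subset[OF \<pi>]) (use \<open>m \<le> n\<close> in auto)
  fix x
  show "\<not> dist_occurrence r k q n \<pi> x"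
  proof
    assume occ: "dist_occurrence r k q n \<pi> x"
    have gap: "x i + (r + 1) \<le> x (i + 1)" and "1 \<le> x i" and inv: "\<pi> (x (i + 1)) < \<pi> (x i)"
      using occ i descent unfolding dist_occurrence_def by auto
    then have "m < x (i + 1)" using \<open>m \<le> r + 1\<close> by linarith
    then have "\<pi> (x (i + 1)) = x (i + 1)"
      by (intro permutes_not_in[OF \<pi>]) auto
    moreover have "\<pi> (x i) < x (i + 1)"
    proof (cases "x i \<le> m")
      case True
      then have "\<pi> (x i) \<in> {Suc 0..m}"
        using permutes_in_image[OF \<pi>] \<open>1 \<le> x i\<close> by auto
      then show ?thesis using \<open>m < x (i + 1)\<close> by auto
    next
      case False
      then have "\<pi> (x i) = x i" by (intro permutes_not_in[OF \<pi>]) auto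
      then show ?thesis using gap by linarith
    qed
    ultimately show False using inv by linarith
  qed
qed

lemma finite_Av_dist: "finite (Av_dist n r k q)"
  by (rule finite_subset[OF _ finite_permutations[of "{1..n}"]]) (auto simp: Av_dist_def)

lemma fact_le_card_Av_dist:
  assumes "i \<in> {1..<k}" "q (i + 1) < q i" "m \<le> n" "m \<le> r + 1"
  shows "fact m \<le> card (Av_dist n r k q)"
  using card_mono[OF finite_Av_dist permutes_prefix_subset_Av_dist[OF assms]]
  by (simp add: card_permutations)

text \<open>The quotients are the terms of the convergent exponential series, so they tend to
  0.\<close>

lemma eventually_power_less_fact: "eventually (\<lambda>m. a ^ m < (fact m :: real)) sequentially"
proof -
  have "(\<lambda>m. inverse (fact m) * a ^ m) \<longlonglongrightarrow> 0"
    by (rule summable_LIMSEQ_zero[OF summable_exp])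
  then have "eventually (\<lambda>m. inverse (fact m) * a ^ m < 1) sequentially"
    by (rule order_tendstoD) simp
  then show ?thesis
    by eventually_elim (simp add: field_simps)
qed

lemma no_linear_dist_growth_rate_of_descent:
  assumes "i \<in> {1..<k}" "q (i + 1) < q i"
  shows "\<not> has_linear_dist_growth_rate k q"
proof
  assume "has_linear_dist_growth_rate k q"
  then obtain c d :: real where d: "0 < d" "d < 1" and
    lim: "(\<lambda>n. root n (real (card (Av_dist n (nat \<lfloor>d * real n\<rfloor>) k q)))) \<longlonglongrightarrow> c"
    unfolding has_linear_dist_growth_rate_def by blast
  define r where "r n = nat \<lfloor>d * real n\<rfloor>" for n :: nat
  \<comment> \<open>Lying strictly above the supposed limit, \<open>B\<close> eventually bounds the
    roots; being at least 1, it has powers monotone in the exponent.\<close>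
  define B where "B = max 1 (c + 1)"
  \<comment> \<open>Chosen so that \<open>n \<le> D * (r n + 1)\<close>: then \<open>B ^ n\<close>
    is at most a power of the fixed base \<open>B ^ D\<close> with exponent \<open>r n + 1\<close>,
    comparable with \<open>fact (r n + 1)\<close>.\<close>
  define D where "D = nat \<lceil>1 / d\<rceil>"
  have "1 \<le> B" "c < B" by (auto simp: B_def)
  have "real (r n) \<ge> d * real n - 1" for n
    using d by (simp add: r_def)
  \<comment> \<open>The added 1 absorbs the loss from the floor.\<close>
  then have dr: "d * real n \<le> real (r n + 1)" for n
    by (simp add: algebra_simps)
  have r_top: "filterlim (\<lambda>n. r n + 1) sequentially sequentially"
  proof -
    have "filterlim (\<lambda>n. d * real n) at_top sequentially"
      using d by (intro filterlim_tendsto_pos_mult_at_top[OF tendsto_const]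
          filterlim_real_sequentially) auto
    then have "filterlim (\<lambda>n. real (r n + 1)) at_top sequentially"
      by (rule filterlim_at_top_mono) (use dr in auto)
    then show ?thesis
      by (simp only: filterlim_sequentially_iff_filterlim_real)
  qed
  have n_le: "n \<le> D * (r n + 1)" for n
  proof -
    have "real n \<le> (1 / d) * real (r n + 1)"
      using dr[of n] d by (simp add: field_simps)
    also have "\<dots> \<le> real D * real (r n + 1)"
      unfolding D_def by (intro mult_right_mono) linarith+
    finally show ?thesis
      by (metis of_nat_le_iff of_nat_mult)
  qed
  have "eventually (\<lambda>n. root n (real (card (Av_dist n (r n) k q))) < B) sequentially"
    using order_tendstoD(2)[OF lim \<open>c < B\<close>] by (simp add: r_def)
  moreover have "eventually (\<lambda>n. (B ^ D) ^ (r n + 1) < fact (r n + 1)) sequentially"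
    using eventually_compose_filterlim[OF eventually_power_less_fact r_top] .
  ultimately have "eventually (\<lambda>n::nat. False) sequentially"
    using eventually_gt_at_top[of 0]
  proof eventually_elim
    case (elim n)
    \<comment> \<open>Here \<open>d < 1\<close> and \<open>0 < n\<close> ensure that the prefix of
      length \<open>r n + 1\<close> fits into the permutation.\<close>
    have "r n < n"
    proof -
      have "d * real n < real n" using d elim by simp
      then show ?thesis using d elim by (simp add: r_def nat_less_iff floor_less_iff)
    qed
    then have "fact (r n + 1) \<le> card (Av_dist n (r n) k q)"
      using fact_le_card_Av_dist[OF assms, of "r n + 1" n "r n"] by simp
    then have "fact (r n + 1) \<le> real (card (Av_dist n (r n) k q))"
      by (metis of_nat_fact of_nat_le_iff)
    also have "\<dots> = root n (real (card (Av_dist n (r n) k q))) ^ n"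
      using elim by simp
    also have "\<dots> \<le> B ^ n"
      using elim by (intro power_mono) auto
    also have "\<dots> \<le> B ^ (D * (r n + 1))"
      using \<open>1 \<le> B\<close> n_le by (rule power_increasing[rotated])
    finally show False
      using elim(2) by (simp only: power_mult[symmetric])
  qed
  then show False by simp
qed

theorem theorem7p2:
  "\<not> (\<forall>k q. 1 \<le> k \<and> q permutes {1..k} \<longrightarrow> has_linear_dist_growth_rate k q) \<and>
   \<not> (\<forall>k q. 2 \<le> k \<and> q permutes {1..k} \<longrightarrow> has_linear_dist_growth_rate k q)"
proof -
  \<comment> \<open>The pattern 21 has length 2, so this one counterexample settles both
    conjuncts.\<close>
  let ?q = "transpose 1 2 :: nat \<Rightarrow> nat"
  have "?q permutes {1..2}"
    by (rule permutes_swap_id) auto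
  moreover have "\<not> has_linear_dist_growth_rate 2 ?q"
    by (rule no_linear_dist_growth_rate_of_descent[of 1]) (auto simp: numeral_2_eq_2)
  ultimately show ?thesis
    by (metis one_le_numeral order_refl)
qed

end
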